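(* Let $F:\mathbb{R}^p\to\mathbb{R}^m$ be continuously differentiable and let $x^*\in\mathbb{R}^p$ satisfy $F(x^* )=0$. Consider the iterates $x^k$ of the Newton-Raphson method $$x^{k+1}=x^k-\gamma\big(DF(x^k)^\top\big)^\dagger F(x^k),\qquad 0<\gamma<1,\ x^0\in\mathbb{R}^p,$$ and let $n(x)=-(DF(x)^\top)^\dagger F(x)$. If $$F(x)\in\mathrm{Im}(DF(x)^\top)\qquad\text{and}\qquad\frac12\|n(x)\|^2\le\langle n(x),x^*-x\rangle$$ hold for every $x=x^k$, $k\ge0$, then there exists $L>0$ such that $\|DF(x^k)\|\le L$ for all $k$, and, for every $k\ge1$, $$\min_{t=0,\dots,k-1}\|F(x^t)\|^2\le\frac1k\cdot\frac{L^2\|x^0-x^*\|^2}{\gamma(1-\gamma)}.$$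
   Context: $DF(x)=[\nabla F_1(x)\ \cdots\ \nabla F_m(x)]\in\mathbb{R}^{p\times m}$ is the transpose of the Jacobian of $F$ at $x$; $\dagger$ is the Moore-Penrose pseudoinverse; $\mathrm{Im}$ is the image (column space); $\|\cdot\|$ is the Euclidean norm for vectors and the induced operator norm for matrices. *)

theory Defs
  imports "HOL-Analysis.Analysis"
begin

text \<open>The Moore-Penrose pseudoinverse, characterised by the four Penrose equations.
  Existence and uniqueness are shown below, so that the definite description denotes.\<close>

definition is_pseudoinverse :: "real^'n^'m \<Rightarrow> real^'m^'n \<Rightarrow> bool" where
  "is_pseudoinverse A X \<longleftrightarrow>
     A ** X ** A = A \<and> X ** A ** X = X \<and>
     transpose (A ** X) = A ** X \<and> transpose (X ** A) = X ** A"

definition pseudoinverse :: "real^'n^'m \<Rightarrow> real^'m^'n" where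
  "pseudoinverse A = (THE X. is_pseudoinverse A X)"

lemma is_pseudoinverse_unique:
  fixes A :: "real^'n^'m"
  assumes "is_pseudoinverse A X" "is_pseudoinverse A Y"
  shows "X = Y"
proof -
  have x: "A ** X ** A = A" "X ** A ** X = X"
      "transpose (A ** X) = A ** X" "transpose (X ** A) = X ** A"
    and y: "A ** Y ** A = A" "Y ** A ** Y = Y"
      "transpose (A ** Y) = A ** Y" "transpose (Y ** A) = Y ** A"
    using assms by (auto simp: is_pseudoinverse_def)
  have "A ** X = (A ** Y) ** (A ** X)"
    using y(1) by (simp add: matrix_mul_assoc)
  also have "\<dots> = transpose ((A ** X) ** (A ** Y))"
    using x(3) y(3) by (simp add: matrix_transpose_mul[of "A ** X" "A ** Y"])
  also have "(A ** X) ** (A ** Y) = A ** Y"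
    using x(1) by (simp add: matrix_mul_assoc)
  finally have ax: "A ** X = A ** Y" using y(3) by simp
  have "X ** A = (X ** A) ** (Y ** A)"
    using y(1) by (metis matrix_mul_assoc)
  also have "\<dots> = transpose ((Y ** A) ** (X ** A))"
    using x(4) y(4) by (simp add: matrix_transpose_mul[of "Y ** A" "X ** A"])
  also have "(Y ** A) ** (X ** A) = Y ** A"
    using x(1) by (metis matrix_mul_assoc)
  finally have xa: "X ** A = Y ** A" using y(4) by simp
  show ?thesis using x(2) y(2) ax xa by (metis matrix_mul_assoc)
qed

lemma normal_equation_solvable:
  fixes A :: "real^'n^'m"
  obtains Y :: "real^'m^'n" where "transpose A ** A ** Y = transpose A"
proof -
  have "\<exists>v. transpose A *v (A *v v) = transpose A *v w" for w :: "real^'m"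
  proof -
    have sub: "subspace (range ((*v) A))"
      by (intro linear_subspace_image matrix_vector_mul_linear subspace_UNIV)
    obtain y z where yz: "y \<in> span (range ((*v) A))"
      "\<And>u. u \<in> span (range ((*v) A)) \<Longrightarrow> orthogonal z u" "w = y + z"
      using orthogonal_subspace_decomp_exists[of "range ((*v) A)" w] by blast
    have sp: "span (range ((*v) A)) = range ((*v) A)" using sub by (simp only: span_eq_iff)
    have "(transpose A *v z) \<bullet> u = 0" for u
      using yz(2)[of "A *v u"] unfolding sp
      by (simp add: orthogonal_def dot_lmul_matrix)
    then have "transpose A *v z = 0"
      by (metis inner_eq_zero_iff)
    moreover obtain v where "y = A *v v" using yz(1) sp by auto
    ultimately show ?thesis using yz(3) by (auto simp: matrix_vector_right_distrib)
  qed
  then obtain g where g: "\<And>w. transpose A *v (A *v g w) = transpose A *v w" by metis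
  define Y :: "real^'m^'n" where "Y = (\<chi> i j. g (axis j 1) $ i)"
  have col: "Y *v axis j 1 = g (axis j 1)" for j
    by (simp add: Y_def vec_eq_iff matrix_vector_mult_basis column_def)
  have "column j (transpose A ** A ** Y) = column j (transpose A)" for j
    unfolding matrix_vector_mult_basis[symmetric]
    by (simp add: matrix_vector_mul_assoc[symmetric] col g del: matrix_vector_mult_basis transpose_matrix_vector)
  then have "transpose A ** A ** Y = transpose A"
    by (simp add: vec_eq_iff column_def)
  then show thesis by (rule that)
qed

lemma is_pseudoinverse_exists:
  fixes A :: "real^'n^'m"
  shows "\<exists>X. is_pseudoinverse A X"
proof -
  have one_three: "\<exists>Y. B ** Y ** B = B \<and> transpose (B ** Y) = B ** Y"
    for B :: "real^'a^'b"
  proof -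
    obtain Y where Y: "transpose B ** B ** Y = transpose B"
      by (rule normal_equation_solvable)
    have "transpose (B ** Y) ** (B ** Y) = transpose (B ** Y)"
      using Y by (metis matrix_mul_assoc matrix_transpose_mul)
    then have sym: "transpose (B ** Y) = B ** Y"
      by (metis matrix_transpose_mul transpose_transpose)
    have "transpose (B ** Y) ** B = B"
      using Y by (metis matrix_mul_assoc matrix_transpose_mul transpose_transpose)
    then show ?thesis using sym by auto
  qed
  obtain Y where Y: "A ** Y ** A = A" "transpose (A ** Y) = A ** Y"
    using one_three by blast
  obtain Z' where Z': "transpose A ** Z' ** transpose A = transpose A"
    "transpose (transpose A ** Z') = transpose A ** Z'"
    using one_three by blast
  define Z where "Z = transpose Z'"
  have Z: "A ** Z ** A = A" "transpose (Z ** A) = Z ** A"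
    using Z' unfolding Z_def
    by (metis matrix_mul_assoc matrix_transpose_mul transpose_transpose)+
  have l: "A ** (Z ** A ** Y) = A ** Y" and r: "(Z ** A ** Y) ** A = Z ** A"
    using Y(1) Z(1) by (metis matrix_mul_assoc)+
  have "is_pseudoinverse A (Z ** A ** Y)"
    unfolding is_pseudoinverse_def l r
    using Y Z by (metis matrix_mul_assoc)
  then show ?thesis by blast
qed

lemma is_pseudoinverse_pseudoinverse: "is_pseudoinverse A (pseudoinverse A)"
  unfolding pseudoinverse_def
  using is_pseudoinverse_exists is_pseudoinverse_unique by (metis theI)

definition continuously_differentiable :: "(real^'p \<Rightarrow> real^'m) \<Rightarrow> bool" where
  "continuously_differentiable F \<longleftrightarrow>
     F differentiable_on UNIV \<and> continuous_on UNIV (\<lambda>x. jacobian F (at x))"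

text \<open>The columns of \<open>DF F x\<close> are the gradients of the components of \<open>F\<close>, i.e. it is the
  transpose of the Jacobian (whose rows are indexed by the components).\<close>

definition DF :: "(real^'p \<Rightarrow> real^'m) \<Rightarrow> real^'p \<Rightarrow> real^'m^'p" where
  "DF F x = transpose (jacobian F (at x))"

definition newton_dir :: "(real^'p \<Rightarrow> real^'m) \<Rightarrow> real^'p \<Rightarrow> real^'p" where
  "newton_dir F x = - (pseudoinverse (transpose (DF F x)) *v F x)"

text \<open>The library's \<open>norm\<close> on matrices is the Frobenius norm; the induced operator norm
  has to be taken of the associated linear map.\<close>

definition opnorm :: "real^'n^'m \<Rightarrow> real" where
  "opnorm A = onorm ((*v) A)"

end

theory Submission
  imports Defs
begin

text \<open>Expanding the square, the hypothesis on \<open>n(x)\<close> yields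
  \<open>\<parallel>x\<^sup>k\<^sup>+\<^sup>1 - x*\<parallel>\<^sup>2 \<le> \<parallel>x\<^sup>k - x*\<parallel>\<^sup>2 - \<gamma>(1 - \<gamma>) \<parallel>n(x\<^sup>k)\<parallel>\<^sup>2\<close>. Hence the iterates stay in a compact ball,
  on which the continuous Jacobian is bounded by some \<open>L\<close>. As \<open>F(x\<^sup>k)\<close> lies in the image of the
  Jacobian \<open>J\<close>, it equals \<open>- J n(x\<^sup>k)\<close>, so \<open>\<parallel>F(x\<^sup>k)\<parallel> \<le> L \<parallel>n(x\<^sup>k)\<parallel>\<close>; telescoping finishes the proof.\<close>

lemma norm_matrix_vector_mult_le_opnorm:
  fixes A :: "real^'n^'m"
  shows "norm (A *v v) \<le> opnorm A * norm v"
  unfolding opnorm_def by (rule onorm) simp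

text \<open>Cauchy-Schwarz in each row bounds every component of \<open>A *v v\<close>. This
  comparison turns a bound in the Frobenius \<open>norm\<close>, the one that compactness delivers,
  into a bound on \<open>opnorm\<close>.\<close>

lemma opnorm_le_norm:
  fixes A :: "real^'n^'m"
  shows "opnorm A \<le> norm A"
  unfolding opnorm_def
proof (rule onorm_le)
  fix v :: "real^'n"
  have comp: "norm ((A *v v) $ i) \<le> norm (A $ i) * norm v" for i
    using Cauchy_Schwarz_ineq2[of "A $ i" v]
    by (simp add: matrix_vector_mult_def inner_vec_def)
  have "norm (A *v v) \<le> L2_set (\<lambda>i. norm (A $ i) * norm v) UNIV"
    unfolding norm_vec_def[of "A *v v"] by (rule L2_set_mono) (use comp in auto)
  also have "\<dots> = norm A * norm v"
    unfolding norm_vec_def[of A] by (simp add: L2_set_left_distrib)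
  finally show "norm (A *v v) \<le> norm A * norm v" .
qed

text \<open>By adjointness, \<open>z = transpose B *v y\<close> satisfies
  \<open>(norm z)\<^sup>2 = y \<bullet> (B *v z)\<close>, and dividing by \<open>norm z\<close>
  gives one inequality; applying it to \<open>A\<close> and to \<open>transpose A\<close> gives
  both.\<close>

lemma opnorm_transpose:
  fixes A :: "real^'n^'m"
  shows "opnorm (transpose A) = opnorm A"
proof -
  have le: "opnorm (transpose B) \<le> opnorm B" for B :: "real^'a^'b"
    unfolding opnorm_def[of "transpose B"]
  proof (rule onorm_le)
    fix y :: "real^'b"
    let ?z = "transpose B *v y"
    have "(norm ?z)\<^sup>2 = y \<bullet> (B *v ?z)"
      by (simp add: power2_norm_eq_inner dot_lmul_matrix)
    also have "\<dots> \<le> norm y * (opnorm B * norm ?z)"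
      by (meson norm_cauchy_schwarz norm_matrix_vector_mult_le_opnorm mult_left_mono
          norm_ge_zero order_trans)
    finally have sq: "norm ?z * norm ?z \<le> (opnorm B * norm y) * norm ?z"
      by (simp add: power2_eq_square mult_ac)
    have "0 \<le> opnorm B" by (simp add: opnorm_def onorm_pos_le)
    \<comment> \<open>Cancelling \<open>norm ?z\<close> requires it to be nonzero; otherwise the
      claim only says that the right-hand side is nonnegative.\<close>
    with sq show "norm ?z \<le> opnorm B * norm y"
      by (cases "norm ?z = 0") (auto simp del: transpose_matrix_vector)
  qed
  from le[of A] le[of "transpose A"] show ?thesis by simp
qed

text \<open>Writing \<open>b = A *v v\<close> reduces this to the first Penrose equation.\<close>

lemma matrix_mult_pseudoinverse_range:
  fixes A :: "real^'n^'m"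
  assumes "b \<in> range ((*v) A)"
  shows "A *v (pseudoinverse A *v b) = b"
  using assms is_pseudoinverse_pseudoinverse[of A]
  by (auto simp: is_pseudoinverse_def matrix_vector_mul_assoc)

lemma norm_le_opnorm_DF_newton_dir:
  assumes "F x \<in> range ((*v) (transpose (DF F x)))"
  shows "norm (F x) \<le> opnorm (DF F x) * norm (newton_dir F x)"
proof -
  have "F x = - (transpose (DF F x) *v newton_dir F x)"
    using matrix_mult_pseudoinverse_range[OF assms]
    by (simp add: newton_dir_def linear_neg[OF matrix_vector_mul_linear]
        del: transpose_matrix_vector)
  then show ?thesis
    by (metis norm_matrix_vector_mult_le_opnorm norm_minus_cancel opnorm_transpose)
qed

text \<open>A set of iterates need not be closed, so the continuous Jacobian is bounded on the
  compact closure of \<open>S\<close>.\<close>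

lemma bounded_opnorm_DF:
  assumes "continuously_differentiable F" and "bounded S"
  obtains L where "0 < L" and "\<And>x. x \<in> S \<Longrightarrow> opnorm (DF F x) \<le> L"
proof -
  have "continuous_on (closure S) (\<lambda>x. jacobian F (at x))"
    using assms(1) continuous_on_subset unfolding continuously_differentiable_def by blast
  then have "compact ((\<lambda>x. jacobian F (at x)) ` closure S)"
    by (rule compact_continuous_image) (use assms(2) in \<open>simp add: compact_closure\<close>)
  then obtain L where L: "0 < L" "\<And>x. x \<in> closure S \<Longrightarrow> norm (jacobian F (at x)) \<le> L"
    using compact_imp_bounded[of "(\<lambda>x. jacobian F (at x)) ` closure S"]
    unfolding bounded_pos by blast
  have "opnorm (DF F x) \<le> L" if "x \<in> S" for x
    unfolding DF_def opnorm_transpose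
    using L(2) opnorm_le_norm that closure_subset by (meson order_trans subsetD)
  with L(1) show thesis by (rule that)
qed

text \<open>The hypothesis makes the cross term of the expanded square at most
  \<open>- \<gamma> * (norm n)\<^sup>2\<close>, which outweighs the quadratic term
  \<open>\<gamma>\<^sup>2 * (norm n)\<^sup>2\<close> when \<open>\<gamma> < 1\<close>.\<close>

lemma norm_relaxed_step_le:
  fixes x n z :: "'a::real_inner"
  assumes "0 \<le> \<gamma>" and "1/2 * (norm n)\<^sup>2 \<le> n \<bullet> (z - x)"
  shows "(norm (x + \<gamma> *\<^sub>R n - z))\<^sup>2 \<le> (norm (x - z))\<^sup>2 - \<gamma> * (1 - \<gamma>) * (norm n)\<^sup>2"
proof -
  have "(norm (x + \<gamma> *\<^sub>R n - z))\<^sup>2 = (norm ((x - z) + \<gamma> *\<^sub>R n))\<^sup>2"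
    by (simp add: algebra_simps)
  also have "\<dots> = (norm (x - z))\<^sup>2 - 2 * \<gamma> * (n \<bullet> (z - x)) + \<gamma>\<^sup>2 * (norm n)\<^sup>2"
    unfolding power2_norm_eq_inner
    by (simp add: inner_simps inner_commute power2_eq_square algebra_simps)
  also have "\<dots> \<le> (norm (x - z))\<^sup>2 - \<gamma> * (norm n)\<^sup>2 + \<gamma>\<^sup>2 * (norm n)\<^sup>2"
    using mult_left_mono[OF assms(2) assms(1)] by simp
  finally show ?thesis by (simp add: algebra_simps power2_eq_square)
qed

text \<open>A minimum is at most the average, and the sum of the decrements of \<open>d\<close>
  telescopes. Since \<open>1 \<le> k\<close>, the truncated subtraction is harmless:
  \<open>{0..k-1}\<close> is \<open>{..<k}\<close>.\<close>

lemma Min_le_average_of_descent: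
  fixes a d :: "nat \<Rightarrow> real"
  assumes "0 < c" and "\<And>t. c * a t \<le> d t - d (Suc t)" and "\<And>t. 0 \<le> d t" and "1 \<le> k"
  shows "Min (a ` {0..k-1}) \<le> 1 / real k * (d 0 / c)"
proof -
  let ?m = "Min (a ` {0..k-1})"
  have "real k * ?m \<le> (\<Sum>t<k. a t)"
    using sum_bounded_below[of "{..<k}" ?m a] by simp
  then have "c * (real k * ?m) \<le> (\<Sum>t<k. c * a t)"
    using assms(1) by (simp add: sum_distrib_left[symmetric])
  also have "\<dots> \<le> (\<Sum>t<k. d t - d (Suc t))"
    by (rule sum_mono) (rule assms(2))
  also have "\<dots> \<le> d 0"
    using assms(3)[of k] by (simp add: sum_lessThan_telescope')
  finally show ?thesis
    using assms(1,4) by (simp add: field_simps)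
qed

theorem corollary5p1:
  fixes F :: "real^'p \<Rightarrow> real^'m"
    and xstar :: "real^'p"
    and x :: "nat \<Rightarrow> real^'p"
    and \<gamma> :: real
  assumes "continuously_differentiable F"
    and "F xstar = 0"
    and "0 < \<gamma>" and "\<gamma> < 1"
    and "\<And>k. x (Suc k) = x k - \<gamma> *\<^sub>R (pseudoinverse (transpose (DF F (x k))) *v F (x k))"
    and "\<And>k. F (x k) \<in> range ((*v) (transpose (DF F (x k))))"
    and "\<And>k. 1/2 * (norm (newton_dir F (x k)))\<^sup>2 \<le> newton_dir F (x k) \<bullet> (xstar - x k)"
  shows "\<exists>L>0. (\<forall>k. opnorm (DF F (x k)) \<le> L) \<and>
           (\<forall>k\<ge>1. Min ((\<lambda>t. (norm (F (x t)))\<^sup>2) ` {0..k-1})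
              \<le> 1 / real k * (L\<^sup>2 * (norm (x 0 - xstar))\<^sup>2 / (\<gamma> * (1 - \<gamma>))))"
proof -
  let ?d = "\<lambda>k. (norm (x k - xstar))\<^sup>2"
  let ?n = "\<lambda>k. newton_dir F (x k)"
  have c: "0 < \<gamma> * (1 - \<gamma>)" using assms(3,4) by simp
  have step: "\<gamma> * (1 - \<gamma>) * (norm (?n k))\<^sup>2 \<le> ?d k - ?d (Suc k)" for k
  proof -
    have "x (Suc k) = x k + \<gamma> *\<^sub>R ?n k"
      using assms(5)[of k] by (simp add: newton_dir_def)
    then show ?thesis
      using norm_relaxed_step_le[OF _ assms(7)[of k], of \<gamma>] assms(3) by simp
  qed
  have "?d (Suc k) \<le> ?d k" for k
    using step[of k] mult_nonneg_nonneg[OF less_imp_le[OF c] zero_le_power2[of "norm (?n k)"]]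
    by linarith
  then have "?d k \<le> ?d 0" for k
    using lift_Suc_antimono_le[of ?d 0 k] by simp
  then have "norm (x k - xstar) \<le> norm (x 0 - xstar)" for k
    using power2_le_imp_le norm_ge_zero by blast
  then have "range x \<subseteq> cball xstar (norm (x 0 - xstar))"
    by (auto simp: dist_norm norm_minus_commute)
  then have "bounded (range x)"
    using bounded_cball bounded_subset by blast
  then obtain L where L: "0 < L" "\<And>k. opnorm (DF F (x k)) \<le> L"
    using bounded_opnorm_DF[OF assms(1)] by (metis rangeI)
  have "norm (F (x k)) \<le> L * norm (?n k)" for k
    using norm_le_opnorm_DF_newton_dir[of F, OF assms(6)[of k]] L(2)[of k]
    by (meson mult_right_mono norm_ge_zero order_trans)
  then have Fn: "(norm (F (x k)))\<^sup>2 \<le> L\<^sup>2 * (norm (?n k))\<^sup>2" for k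
    by (metis norm_ge_zero power_mono power_mult_distrib)
  \<comment> \<open>Scaling the squared distance by \<open>L\<^sup>2\<close> gives a potential whose
    decrease controls the residual \<open>F (x k)\<close> instead of the direction
    \<open>?n k\<close>.\<close>
  have descent: "\<gamma> * (1 - \<gamma>) * (norm (F (x k)))\<^sup>2 \<le> L\<^sup>2 * ?d k - L\<^sup>2 * ?d (Suc k)" for k
  proof -
    have "\<gamma> * (1 - \<gamma>) * (norm (F (x k)))\<^sup>2 \<le> \<gamma> * (1 - \<gamma>) * (L\<^sup>2 * (norm (?n k))\<^sup>2)"
      using Fn c by (intro mult_left_mono) auto
    also have "\<dots> = L\<^sup>2 * (\<gamma> * (1 - \<gamma>) * (norm (?n k))\<^sup>2)" by simp
    also have "\<dots> \<le> L\<^sup>2 * (?d k - ?d (Suc k))"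
      using step by (intro mult_left_mono) auto
    finally show ?thesis by (simp add: right_diff_distrib)
  qed
  have "Min ((\<lambda>t. (norm (F (x t)))\<^sup>2) ` {0..k-1})
      \<le> 1 / real k * (L\<^sup>2 * ?d 0 / (\<gamma> * (1 - \<gamma>)))" if "1 \<le> k" for k
    using Min_le_average_of_descent[of _ _ "\<lambda>k. L\<^sup>2 * ?d k", OF c descent _ that] by simp
  with L show ?thesis by blast
qed

end
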